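(* Let $K$ be a field of characteristic zero, and let $m$ and $n$ be positive integers with $m<n$. Then the first Weyl algebra $\mathbb{A}_K$ does not embed into $L_K(m,n)$; that is, there is no injective $K$-algebra homomorphism $\mathbb{A}_K\to L_K(m,n)$.
   Context: The first Weyl algebra over $K$ is $\mathbb{A}_K=K\langle x,y\rangle/\langle xy-yx-1\rangle$. For positive integers $m<n$, the Leavitt algebra $L_K(m,n)$ is the unital associative $K$-algebra generated by symbols $x_{ij}$, $y_{ji}$ ($1\le i\le m$, $1\le j\le n$) subject to the relations obtained entrywise from $AB=I_m$ and $BA=I_n$, where $A=(x_{ij})$ is regarded as an $m\times n$ matrix and $B=(y_{ji})$ as an $n\times m$ matrix. *)

theory Defs
  imports
    "HOL-Algebra.QuotRing"
    "HOL-Algebra.Module"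
    "HOL-Library.Poly_Mapping"
begin

section \<open>Free algebras\<close>

text \<open>
  Words form the free monoid. It is written additively because the convolution product of
  \<open>Poly_Mapping\<close> is indexed by an additive (not necessarily commutative) monoid; thus
  \<open>'g word \<Rightarrow>\<^sub>0 'k\<close> is the free associative \<open>'k\<close>-algebra on \<open>'g\<close>. The wrapper around lists keeps
  the type class instance away from other structures on lists.
\<close>

datatype 'g word = Word (letters: "'g list")

instantiation word :: (type) monoid_add
begin

definition zero_word :: "'a word" where
  "0 = Word []"

definition plus_word :: "'a word \<Rightarrow> 'a word \<Rightarrow> 'a word" where
  "u + v = Word (letters u @ letters v)"

instance
  by standard (auto simp: zero_word_def plus_word_def)

end

lemma letters_zero [simp]: "letters 0 = []"
  by (simp add: zero_word_def)

lemma letters_plus [simp]: "letters (u + v) = letters u @ letters v"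
  by (simp add: plus_word_def)

type_synonym ('g, 'k) nc_poly = "'g word \<Rightarrow>\<^sub>0 'k"

definition gen :: "'g \<Rightarrow> ('g, 'k::field) nc_poly" where
  "gen g = Poly_Mapping.single (Word [g]) 1"

definition free_algebra :: "'g set \<Rightarrow> ('k::field, ('g, 'k) nc_poly) module" where
  "free_algebra X =
     \<lparr>carrier = {p. \<forall>w\<in>Poly_Mapping.keys p. set (letters w) \<subseteq> X},
      mult = (*), one = 1, zero = 0, add = (+),
      smult = (\<lambda>c p. Poly_Mapping.single 0 c * p)\<rparr>"


section \<open>Quotient algebras, presentations and homomorphisms\<close>

definition quotient_algebra :: "('k, 'a) module \<Rightarrow> 'a set \<Rightarrow> ('k, 'a set) module" where
  "quotient_algebra A I =
     ring.extend (A Quot I)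
       (module.fields (\<lambda>c C. \<Union>a\<in>C. I +>\<^bsub>A\<^esub> (c \<odot>\<^bsub>A\<^esub> a)))"

definition presented_algebra ::
    "'g set \<Rightarrow> ('g, 'k::field) nc_poly set \<Rightarrow> ('k, ('g, 'k) nc_poly set) module" where
  "presented_algebra X R = quotient_algebra (free_algebra X) (Idl\<^bsub>free_algebra X\<^esub> R)"

text \<open>The scalars are the whole type \<open>'k\<close>. Homomorphisms are unital, as \<^const>\<open>ring_hom\<close> is.\<close>

definition algebra_hom :: "('k, 'a) module \<Rightarrow> ('k, 'b) module \<Rightarrow> ('a \<Rightarrow> 'b) set" where
  "algebra_hom A B =
     {h \<in> ring_hom A B. \<forall>c. \<forall>a\<in>carrier A. h (c \<odot>\<^bsub>A\<^esub> a) = c \<odot>\<^bsub>B\<^esub> h a}"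


section \<open>The first Weyl algebra\<close>

datatype weyl_gen = WX | WY

type_synonym 'k weyl = "(weyl_gen, 'k) nc_poly set"

definition weyl_algebra :: "('k::field, 'k weyl) module" where
  "weyl_algebra = presented_algebra {WX, WY} {gen WX * gen WY - gen WY * gen WX - 1}"


section \<open>Leavitt algebras\<close>

text \<open>
  \<open>LX i j\<close> is the entry of \<open>A\<close> in row \<open>i\<close> and column \<open>j\<close>, and \<open>LY j i\<close> is the entry of \<open>B\<close> in
  row \<open>j\<close> and column \<open>i\<close>.
\<close>

datatype leavitt_gen = LX nat nat | LY nat nat

type_synonym 'k leavitt = "(leavitt_gen, 'k) nc_poly set"

definition leavitt_gens :: "nat \<Rightarrow> nat \<Rightarrow> leavitt_gen set" where
  "leavitt_gens m n =
     {LX i j | i j. i \<in> {1..m} \<and> j \<in> {1..n}} \<union> {LY j i | i j. i \<in> {1..m} \<and> j \<in> {1..n}}"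

definition leavitt_rels :: "nat \<Rightarrow> nat \<Rightarrow> (leavitt_gen, 'k::field) nc_poly set" where
  "leavitt_rels m n =
     {(\<Sum>j = 1..n. gen (LX i j) * gen (LY j k)) - (if i = k then 1 else 0) | i k.
        i \<in> {1..m} \<and> k \<in> {1..m}} \<union>
     {(\<Sum>i = 1..m. gen (LY j i) * gen (LX i l)) - (if j = l then 1 else 0) | j l.
        j \<in> {1..n} \<and> l \<in> {1..n}}"

definition leavitt_algebra :: "nat \<Rightarrow> nat \<Rightarrow> ('k::field, 'k leavitt) module" where
  "leavitt_algebra m n = presented_algebra (leavitt_gens m n) (leavitt_rels m n)"


section \<open>Well-definedness\<close>

lemma free_algebra_simps [simp]:
  "mult (free_algebra X) = (*)" "one (free_algebra X) = 1"
  "zero (free_algebra X) = 0" "add (free_algebra X) = (+)"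
  "smult (free_algebra X) c p = Poly_Mapping.single 0 c * p"
  by (simp_all add: free_algebra_def)

lemma in_free_algebra:
  "p \<in> carrier (free_algebra X) \<longleftrightarrow> (\<forall>w\<in>Poly_Mapping.keys p. set (letters w) \<subseteq> X)"
  by (simp add: free_algebra_def)

lemma free_algebra_mult:
  assumes "p \<in> carrier (free_algebra X)" "q \<in> carrier (free_algebra X)"
  shows "p * q \<in> carrier (free_algebra X)"
  unfolding in_free_algebra
proof
  fix w assume "w \<in> Poly_Mapping.keys (p * q)"
  then obtain u v where "w = u + v" "u \<in> Poly_Mapping.keys p" "v \<in> Poly_Mapping.keys q"
    using keys_mult[of p q] by auto
  with assms show "set (letters w) \<subseteq> X"
    unfolding in_free_algebra by auto
qed

lemma free_algebra_add:
  assumes "p \<in> carrier (free_algebra X)" "q \<in> carrier (free_algebra X)"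
  shows "p + q \<in> carrier (free_algebra X)"
  using assms keys_add[of p q] unfolding in_free_algebra by blast

lemma free_algebra_uminus:
  assumes "p \<in> carrier (free_algebra X)"
  shows "- p \<in> carrier (free_algebra X)"
  using assms unfolding in_free_algebra by (auto simp: in_keys_iff)

lemma free_algebra_diff:
  assumes "p \<in> carrier (free_algebra X)" "q \<in> carrier (free_algebra X)"
  shows "p - q \<in> carrier (free_algebra X)"
  using free_algebra_add[OF assms(1) free_algebra_uminus[OF assms(2)]] by simp

lemma free_algebra_zero: "0 \<in> carrier (free_algebra X)"
  by (simp add: in_free_algebra)

lemma free_algebra_const: "Poly_Mapping.single 0 c \<in> carrier (free_algebra X)"
  by (simp add: in_free_algebra)

lemma free_algebra_one: "1 \<in> carrier (free_algebra X)"
  using free_algebra_const[of 1 X] by simp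

lemma free_algebra_gen: "g \<in> X \<Longrightarrow> gen g \<in> carrier (free_algebra X)"
  by (simp add: in_free_algebra gen_def)

lemma free_algebra_sum:
  assumes "\<And>i. i \<in> S \<Longrightarrow> f i \<in> carrier (free_algebra X)"
  shows "sum f S \<in> carrier (free_algebra X)"
  using assms
  by (induction S rule: infinite_finite_induct) (auto intro: free_algebra_add free_algebra_zero)

lemmas free_algebra_closed =
  free_algebra_mult free_algebra_add free_algebra_diff free_algebra_zero free_algebra_one
  free_algebra_gen free_algebra_sum

lemma ring_free_algebra:
  fixes X :: "'g set"
  shows "ring (free_algebra X :: ('k::field, ('g, 'k) nc_poly) module)"
proof (rule ringI)
  let ?F = "free_algebra X :: ('k, ('g, 'k) nc_poly) module"
  show "abelian_group ?F"
  proof (rule abelian_groupI)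
    fix p :: "('g, 'k) nc_poly" assume "p \<in> carrier ?F"
    then show "\<exists>q\<in>carrier ?F. q \<oplus>\<^bsub>?F\<^esub> p = \<zero>\<^bsub>?F\<^esub>"
      by (intro bexI[of _ "- p"]) (simp_all add: free_algebra_uminus)
  qed (auto simp: add.assoc add.commute intro: free_algebra_closed)
  show "monoid ?F"
    by (rule monoidI) (auto simp: mult.assoc intro: free_algebra_closed)
qed (auto simp: distrib_left distrib_right)

lemma free_algebra_smult:
  "p \<in> carrier (free_algebra X) \<Longrightarrow> c \<odot>\<^bsub>free_algebra X\<^esub> p \<in> carrier (free_algebra X)"
  by (simp add: free_algebra_mult free_algebra_const)

lemma free_algebra_smult_mult:
  fixes p q :: "('g, 'k::field) nc_poly"
  shows "p * (c \<odot>\<^bsub>free_algebra X\<^esub> q) = c \<odot>\<^bsub>free_algebra X\<^esub> (p * q)"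
proof -
  have "p * Poly_Mapping.single 0 c = Poly_Mapping.single 0 c * p"
  proof (induction p rule: update_induct)
    case (update f a b)
    have "Poly_Mapping.update a b f = f + Poly_Mapping.single a b"
      using update.hyps(1)
      by (intro poly_mapping_eqI)
         (auto simp: lookup_update lookup_add lookup_single when_def in_keys_iff)
    with update.IH show ?case
      by (simp add: distrib_left distrib_right mult_single mult.commute)
  qed simp
  then show ?thesis
    by (simp add: mult.assoc[symmetric])
qed

lemma weyl_rel_closed:
  "{gen WX * gen WY - gen WY * gen WX - 1} \<subseteq> carrier (free_algebra {WX, WY})"
  by (auto intro!: free_algebra_closed)

lemma leavitt_rels_closed: "leavitt_rels m n \<subseteq> carrier (free_algebra (leavitt_gens m n))"
  unfolding leavitt_rels_def leavitt_gens_def by (auto intro!: free_algebra_closed)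

lemma quotient_algebra_simps [simp]:
  "carrier (quotient_algebra A I) = carrier (A Quot I)"
  "mult (quotient_algebra A I) = mult (A Quot I)"
  "one (quotient_algebra A I) = one (A Quot I)"
  "zero (quotient_algebra A I) = zero (A Quot I)"
  "add (quotient_algebra A I) = add (A Quot I)"
  "smult (quotient_algebra A I) c C = (\<Union>a\<in>C. I +>\<^bsub>A\<^esub> (c \<odot>\<^bsub>A\<^esub> a))"
  by (simp_all add: quotient_algebra_def ring.defs module.defs monoid.defs partial_object.defs)

context
  fixes X :: "'g set" and R :: "('g, 'k::field) nc_poly set"
  assumes rels: "R \<subseteq> carrier (free_algebra X)"
begin

interpretation F: ring "free_algebra X"
  by (rule ring_free_algebra)

interpretation I: ideal "Idl\<^bsub>free_algebra X\<^esub> R" "free_algebra X"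
  by (rule F.genideal_ideal[OF rels])

lemma ring_presented_algebra: "ring (presented_algebra X R)"
proof -
  let ?Q = "free_algebra X Quot Idl\<^bsub>free_algebra X\<^esub> R"
  interpret Q: ring ?Q
    by (rule I.quotient_is_ring)
  show ?thesis
    unfolding presented_algebra_def
  proof (rule ringI)
    show "abelian_group (quotient_algebra (free_algebra X) (Idl\<^bsub>free_algebra X\<^esub> R))"
    proof (rule abelian_groupI)
      fix x assume "x \<in> carrier (quotient_algebra (free_algebra X) (Idl\<^bsub>free_algebra X\<^esub> R))"
      then show "\<exists>y\<in>carrier (quotient_algebra (free_algebra X) (Idl\<^bsub>free_algebra X\<^esub> R)).
          y \<oplus>\<^bsub>quotient_algebra (free_algebra X) (Idl\<^bsub>free_algebra X\<^esub> R)\<^esub> x =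
          \<zero>\<^bsub>quotient_algebra (free_algebra X) (Idl\<^bsub>free_algebra X\<^esub> R)\<^esub>"
        by (intro bexI[of _ "\<ominus>\<^bsub>?Q\<^esub> x"]) (simp_all add: Q.l_neg)
    qed (simp_all add: Q.a_ac)
    show "monoid (quotient_algebra (free_algebra X) (Idl\<^bsub>free_algebra X\<^esub> R))"
      by (rule monoidI) (simp_all add: Q.m_assoc)
  qed (simp_all add: Q.l_distr Q.r_distr)
qed

lemma presented_algebra_smult:
  assumes p: "p \<in> carrier (free_algebra X)"
  shows "c \<odot>\<^bsub>presented_algebra X R\<^esub> (Idl\<^bsub>free_algebra X\<^esub> R +>\<^bsub>free_algebra X\<^esub> p) =
         Idl\<^bsub>free_algebra X\<^esub> R +>\<^bsub>free_algebra X\<^esub> (c \<odot>\<^bsub>free_algebra X\<^esub> p)"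
proof -
  let ?F = "free_algebra X" and ?I = "Idl\<^bsub>free_algebra X\<^esub> R"
  have "?I +>\<^bsub>?F\<^esub> (c \<odot>\<^bsub>?F\<^esub> a) = ?I +>\<^bsub>?F\<^esub> (c \<odot>\<^bsub>?F\<^esub> p)" if "a \<in> ?I +>\<^bsub>?F\<^esub> p" for a
  proof -
    obtain h where h: "h \<in> ?I" "a = h + p"
      using \<open>a \<in> _\<close> by (auto simp: a_r_coset_def')
    have "Poly_Mapping.single 0 c * h \<in> ?I"
      using I.I_l_closed[OF h(1) free_algebra_const[of c]] by simp
    then have "c \<odot>\<^bsub>?F\<^esub> a \<in> ?I +>\<^bsub>?F\<^esub> (c \<odot>\<^bsub>?F\<^esub> p)"
      using h(2) by (auto simp: a_r_coset_def' distrib_left)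
    then show ?thesis
      by (rule I.a_repr_independence'[OF _ free_algebra_smult[OF p], symmetric])
  qed
  moreover have "p \<in> ?I +>\<^bsub>?F\<^esub> p"
    using I.a_rcos_self[OF p] .
  ultimately have "(\<Union>a\<in>?I +>\<^bsub>?F\<^esub> p. ?I +>\<^bsub>?F\<^esub> (c \<odot>\<^bsub>?F\<^esub> a)) = ?I +>\<^bsub>?F\<^esub> (c \<odot>\<^bsub>?F\<^esub> p)"
    by blast
  then show ?thesis
    by (simp only: presented_algebra_def quotient_algebra_simps)
qed

end

end

theory Submission
  imports Defs
    "HOL-Computational_Algebra.Fundamental_Theorem_Algebra"
    "HOL-Analysis.Continuum_Not_Denumerable"
begin

text \<open>
  The obstruction is analytic. A unital homomorphism from the Weyl algebra gives two elements
  \<open>p, q\<close> of the Leavitt algebra with \<open>p q - q p = 1\<close>, and bounded operators cannot satisfy this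
  relation: from \<open>p\<^sup>k q - q p\<^sup>k = k p\<^sup>k\<^sup>-\<^sup>1\<close> one gets
  \<open>k \<parallel>p\<^sup>k\<^sup>-\<^sup>1\<parallel> \<le> 2 \<parallel>p\<parallel> \<parallel>q\<parallel> \<parallel>p\<^sup>k\<^sup>-\<^sup>1\<parallel>\<close> for all \<open>k\<close>, so \<open>p\<close> is nilpotent, and then the
  same identity, read for decreasing \<open>k\<close>, forces \<open>1 = 0\<close>
  (Wielandt's theorem, \<open>no_bounded_canonical_pair\<close>).

  The Leavitt algebra acts by such operators. A bijection between \<open>\<nat> \<times> {1..m}\<close> and
  \<open>\<nat> \<times> {1..n}\<close> identifies \<open>m\<close> copies of the space of functions on \<open>\<nat>\<close> with \<open>n\<close> copies, and the
  blocks of this identification and of its inverse satisfy the defining relations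
  (\<open>leavitt_rels_annihilate\<close>). Each block evaluates a function at a moved point or gives \<open>0\<close>, so
  it does not increase the supremum norm.

  The field \<open>K\<close> carries no distinguished absolute value, and it may be too large to embed into
  \<open>\<complex>\<close>. But only finitely many coefficients occur in \<open>p\<close> and \<open>q\<close>, and a finitely generated subring
  of a field of characteristic zero embeds into \<open>\<complex>\<close> (\<open>finite_set_embeds\<close>). The supremum norm is
  therefore taken through this embedding, on functions with values in the subring. The commutation relation
  holds over \<open>K\<close>, and the operators of \<open>p\<close> and \<open>q\<close> preserve the functions on which the norm
  makes sense.
\<close>

section \<open>Embedding finitely generated subrings of a field into the complex numbers\<close>

lemma exists_minimal_degree:
  assumes "g \<in> Z" "g \<noteq> (0 :: 'a::zero poly)"
  shows "\<exists>f\<in>Z. f \<noteq> 0 \<and> (\<forall>h\<in>Z. h \<noteq> 0 \<longrightarrow> degree f \<le> degree h)"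
  using assms ex_has_least_nat[of "\<lambda>g. g \<in> Z \<and> g \<noteq> 0" g degree] by auto

text \<open>
  An embedding is a total function that is only meaningful on \<open>S\<close>; this allows the subring to vary
  within one field type.
\<close>
locale complex_embedding =
  fixes S :: "'k::field_char_0 set" and \<sigma> :: "'k \<Rightarrow> complex"
  assumes one_closed: "1 \<in> S"
    and diff_closed: "x \<in> S \<Longrightarrow> y \<in> S \<Longrightarrow> x - y \<in> S"
    and mult_closed: "x \<in> S \<Longrightarrow> y \<in> S \<Longrightarrow> x * y \<in> S"
    and \<sigma>_one: "\<sigma> 1 = 1"
    and \<sigma>_diff: "x \<in> S \<Longrightarrow> y \<in> S \<Longrightarrow> \<sigma> (x - y) = \<sigma> x - \<sigma> y"
    and \<sigma>_mult: "x \<in> S \<Longrightarrow> y \<in> S \<Longrightarrow> \<sigma> (x * y) = \<sigma> x * \<sigma> y"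
    and \<sigma>_inj: "x \<in> S \<Longrightarrow> \<sigma> x = 0 \<Longrightarrow> x = 0"
begin

lemma zero_closed: "0 \<in> S"
  using diff_closed[OF one_closed one_closed] by simp

lemma \<sigma>_zero: "\<sigma> 0 = 0"
  using \<sigma>_diff[OF one_closed one_closed] by simp

lemma uminus_closed: "x \<in> S \<Longrightarrow> - x \<in> S"
  using diff_closed[OF zero_closed] by fastforce

lemma \<sigma>_uminus: "x \<in> S \<Longrightarrow> \<sigma> (- x) = - \<sigma> x"
  using \<sigma>_diff[OF zero_closed, of x] by (simp add: \<sigma>_zero)

lemma add_closed: "x \<in> S \<Longrightarrow> y \<in> S \<Longrightarrow> x + y \<in> S"
  using diff_closed[OF _ uminus_closed] by fastforce

lemma \<sigma>_add: "x \<in> S \<Longrightarrow> y \<in> S \<Longrightarrow> \<sigma> (x + y) = \<sigma> x + \<sigma> y"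
  using \<sigma>_diff[of x "- y"] by (simp add: uminus_closed \<sigma>_uminus)

lemma sum_closed: "(\<And>i. i \<in> A \<Longrightarrow> f i \<in> S) \<Longrightarrow> sum f A \<in> S"
  by (induction A rule: infinite_finite_induct) (auto intro: zero_closed add_closed)

lemma \<sigma>_sum: "(\<And>i. i \<in> A \<Longrightarrow> f i \<in> S) \<Longrightarrow> \<sigma> (sum f A) = (\<Sum>i\<in>A. \<sigma> (f i))"
  by (induction A rule: infinite_finite_induct) (auto simp: \<sigma>_zero \<sigma>_add sum_closed)

lemma of_nat_closed: "of_nat j \<in> S"
  by (induction j) (auto intro: zero_closed one_closed add_closed)

lemma \<sigma>_of_nat: "\<sigma> (of_nat j) = of_nat j"
  by (induction j) (auto simp: \<sigma>_zero \<sigma>_one \<sigma>_add one_closed of_nat_closed)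

lemma \<sigma>_eq_0_iff: "x \<in> S \<Longrightarrow> \<sigma> x = 0 \<longleftrightarrow> x = 0"
  using \<sigma>_inj \<sigma>_zero by auto

text \<open>
  The polynomial ring \<open>S[X]\<close>.
\<close>
definition polys :: "'k poly set" where
  "polys = {g. \<forall>i. coeff g i \<in> S}"

lemma coeff_closed: "g \<in> polys \<Longrightarrow> coeff g i \<in> S"
  by (simp add: polys_def)

lemma polys_const: "a \<in> S \<Longrightarrow> [:a:] \<in> polys"
  by (auto simp: polys_def coeff_pCons zero_closed split: nat.split)

lemma polys_monom: "a \<in> S \<Longrightarrow> Polynomial.monom a d \<in> polys"
  by (auto simp: polys_def zero_closed)

lemma polys_diff: "g \<in> polys \<Longrightarrow> h \<in> polys \<Longrightarrow> g - h \<in> polys"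
  by (auto simp: polys_def diff_closed)

lemma polys_add: "g \<in> polys \<Longrightarrow> h \<in> polys \<Longrightarrow> g + h \<in> polys"
  by (auto simp: polys_def add_closed)

lemma polys_mult: "g \<in> polys \<Longrightarrow> h \<in> polys \<Longrightarrow> g * h \<in> polys"
  by (auto simp: polys_def coeff_mult intro!: sum_closed mult_closed)

abbreviation \<sigma>p :: "'k poly \<Rightarrow> complex poly" where
  "\<sigma>p \<equiv> map_poly \<sigma>"

lemma coeff_\<sigma>p: "coeff (\<sigma>p g) i = \<sigma> (coeff g i)"
  by (simp add: coeff_map_poly \<sigma>_zero)

lemma \<sigma>p_diff: "g \<in> polys \<Longrightarrow> h \<in> polys \<Longrightarrow> \<sigma>p (g - h) = \<sigma>p g - \<sigma>p h"
  by (auto intro!: poly_eqI simp: coeff_\<sigma>p \<sigma>_diff coeff_closed)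

lemma \<sigma>p_mult: "g \<in> polys \<Longrightarrow> h \<in> polys \<Longrightarrow> \<sigma>p (g * h) = \<sigma>p g * \<sigma>p h"
  by (auto intro!: poly_eqI simp: coeff_\<sigma>p coeff_mult \<sigma>_mult \<sigma>_sum coeff_closed mult_closed)

lemma \<sigma>p_const: "\<sigma>p [:a:] = [:\<sigma> a:]"
  by (auto intro!: poly_eqI simp: coeff_\<sigma>p coeff_pCons \<sigma>_zero split: nat.split)

lemma \<sigma>p_eq_0_iff: "g \<in> polys \<Longrightarrow> \<sigma>p g = 0 \<longleftrightarrow> g = 0"
  by (auto simp: poly_eq_iff coeff_\<sigma>p \<sigma>_eq_0_iff coeff_closed)

lemma degree_\<sigma>p: "g \<in> polys \<Longrightarrow> degree (\<sigma>p g) = degree g"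
  by (cases "g = 0"; intro order_antisym degree_le le_degree allI impI)
     (auto simp: coeff_\<sigma>p \<sigma>_eq_0_iff \<sigma>_zero coeff_closed coeff_eq_0)

text \<open>
  Division in \<open>S[X]\<close> works up to a nonzero factor from \<open>S\<close>: before each elimination step \<open>g\<close> is
  multiplied by the leading coefficient of \<open>f\<close>.
\<close>
lemma pseudo_division:
  assumes "f \<in> polys" "f \<noteq> 0" "g \<in> polys"
  shows "\<exists>a\<in>S - {0}. \<exists>q\<in>polys. \<exists>r\<in>polys.
           [:a:] * g = q * f + r \<and> (r = 0 \<or> degree r < degree f)"
  using assms(3)
proof (induction "if g = 0 then 0 else Suc (degree g)" arbitrary: g rule: less_induct)
  case less
  show ?case
  proof (cases "g = 0 \<or> degree g < degree f")
    case True
    then show ?thesis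
      using less.prems polys_const[OF zero_closed]
      by (intro bexI[of _ 1] bexI[of _ 0] bexI[of _ g]) (auto simp: one_closed)
  next
    case False
    define l where "l = lead_coeff f"
    define t where "t = Polynomial.monom (lead_coeff g) (degree g - degree f)"
    define g' where "g' = [:l:] * g - t * f"
    have l: "l \<in> S" "l \<noteq> 0" and t: "t \<in> polys"
      using assms(1,2) less.prems by (auto simp: l_def t_def coeff_closed polys_monom)
    have g': "g' \<in> polys"
      using l t assms(1) less.prems unfolding g'_def by (intro polys_diff polys_mult polys_const) auto
    have "degree g' \<le> degree g"
      unfolding g'_def
    proof (rule degree_diff_le)
      show "degree (t * f) \<le> degree g"
        using degree_mult_le[of t f] degree_monom_le[of "lead_coeff g" "degree g - degree f"] False
        unfolding t_def by linarith
    qed (use degree_mult_le[of "[:l:]" g] in simp)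
    moreover have "coeff g' (degree g) = 0"
      using False by (simp add: g'_def t_def l_def coeff_monom_mult)
    ultimately have "g' = 0 \<or> degree g' < degree g"
      by (metis leading_coeff_0_iff le_neq_implies_less)
    then have "(if g' = 0 then 0 else Suc (degree g')) < (if g = 0 then 0 else Suc (degree g))"
      using False by auto
    \<comment> \<open>The zero polynomial has measure \<open>0\<close>, below that of nonzero constants, so the induction
      also covers the step that eliminates \<open>g\<close> completely.\<close>
    from less.hyps[OF this g'] obtain a q r where
      IH: "a \<in> S - {0}" "q \<in> polys" "r \<in> polys" "[:a:] * g' = q * f + r"
          "r = 0 \<or> degree r < degree f"
      by metis
    have "[:a * l:] * g = [:a:] * ([:l:] * g)"
      by (simp add: algebra_simps)
    also have "\<dots> = [:a:] * g' + [:a:] * t * f"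
      by (simp add: g'_def algebra_simps)
    finally have "[:a * l:] * g = (q + [:a:] * t) * f + r"
      unfolding IH(4) by (simp add: algebra_simps)
    moreover have "a * l \<in> S - {0}"
      using IH(1) l by (simp add: mult_closed)
    moreover have "q + [:a:] * t \<in> polys"
      using IH(1,2) t by (intro polys_add polys_mult polys_const) auto
    ultimately show ?thesis
      using IH(3,5)
      by (intro bexI[of _ "a * l"] bexI[of _ "q + [:a:] * t"] bexI[of _ r] conjI)
  qed
qed

text \<open>
  The remainder of a pseudo-division lies in the ideal again, so minimality of the degree makes it
  vanish. Thus an ideal of \<open>S[X]\<close> is, up to factors from \<open>S\<close>, generated by any of its nonzero
  elements of least degree.
\<close>
lemma minimal_degree_generates:
  assumes Z: "Z \<subseteq> polys"
    and Z_diff: "\<And>g h. g \<in> Z \<Longrightarrow> h \<in> Z \<Longrightarrow> g - h \<in> Z"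
    and Z_mult: "\<And>q g. q \<in> polys \<Longrightarrow> g \<in> Z \<Longrightarrow> q * g \<in> Z"
    and f: "f \<in> Z" "f \<noteq> 0"
    and min: "\<And>g. g \<in> Z \<Longrightarrow> g \<noteq> 0 \<Longrightarrow> degree f \<le> degree g"
    and g: "g \<in> Z"
  shows "\<exists>a\<in>S - {0}. \<exists>q\<in>polys. [:a:] * g = q * f"
proof -
  obtain a q r where *: "a \<in> S - {0}" "q \<in> polys" "[:a:] * g = q * f + r"
      "r = 0 \<or> degree r < degree f"
    using pseudo_division[of f g] f g Z by (meson subsetD)
  have "r = [:a:] * g - q * f"
    using *(3) by simp
  also have "\<dots> \<in> Z"
    using * f g by (intro Z_diff Z_mult polys_const) auto
  finally have "r = 0"
    using min[of r] *(4) by (cases "r = 0") auto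
  then show ?thesis
    using * by auto
qed

text \<open>
  Let \<open>f\<close> be of least degree among the polynomials that vanish at \<open>c\<close>, and let \<open>z\<close> be a complex
  root of its image. The ideals of polynomials vanishing at \<open>c\<close> and at \<open>z\<close> both contain \<open>f\<close>, so
  they coincide once \<open>f\<close> has least degree in the second one as well. This is the irreducibility of
  \<open>f\<close> in disguise: a generator \<open>h\<close> of the second ideal gives a factorisation \<open>a f = q h\<close>, and
  since \<open>c\<close> lies in a field, \<open>q\<close> or \<open>h\<close> vanishes at \<open>c\<close>.
\<close>
lemma conjugate_of_algebraic:
  assumes f0: "f0 \<in> polys" "f0 \<noteq> 0" "poly f0 c = 0"
  shows "\<exists>z. \<forall>g\<in>polys. poly (\<sigma>p g) z = 0 \<longleftrightarrow> poly g c = 0"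
proof -
  define Zc where "Zc = {g \<in> polys. poly g c = 0}"
  have Zc: "Zc \<subseteq> polys" "\<And>g h. g \<in> Zc \<Longrightarrow> h \<in> Zc \<Longrightarrow> g - h \<in> Zc"
      "\<And>q g. q \<in> polys \<Longrightarrow> g \<in> Zc \<Longrightarrow> q * g \<in> Zc"
    by (auto simp: Zc_def polys_diff polys_mult)
  have "f0 \<in> Zc"
    using f0 by (simp add: Zc_def)
  then obtain f where f: "f \<in> Zc" "f \<noteq> 0" and
      f_min: "\<And>h. h \<in> Zc \<Longrightarrow> h \<noteq> 0 \<Longrightarrow> degree f \<le> degree h"
    using exists_minimal_degree[of f0 Zc] f0(2) by metis
  have "degree f \<noteq> 0"
  proof
    assume "degree f = 0"
    then obtain b where "f = [:b:]"
      by (rule degree_eq_zeroE)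
    then show False
      using f by (simp add: Zc_def)
  qed
  \<comment> \<open>Injectivity of \<open>\<sigma>\<close> preserves the degree, so the image of \<open>f\<close> has a root.\<close>
  then have "\<not> constant (poly (\<sigma>p f))"
    using f by (simp add: constant_degree degree_\<sigma>p Zc_def)
  then obtain z where z: "poly (\<sigma>p f) z = 0"
    using fundamental_theorem_of_algebra by blast
  define Zz where "Zz = {g \<in> polys. poly (\<sigma>p g) z = 0}"
  have Zz: "Zz \<subseteq> polys" "\<And>g h. g \<in> Zz \<Longrightarrow> h \<in> Zz \<Longrightarrow> g - h \<in> Zz"
      "\<And>q g. q \<in> polys \<Longrightarrow> g \<in> Zz \<Longrightarrow> q * g \<in> Zz"
    by (auto simp: Zz_def polys_diff polys_mult \<sigma>p_diff \<sigma>p_mult)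
  have f_Zz: "f \<in> Zz"
    using f z by (simp add: Zc_def Zz_def)
  then obtain h where h: "h \<in> Zz" "h \<noteq> 0" and
      h_min: "\<And>g. g \<in> Zz \<Longrightarrow> g \<noteq> 0 \<Longrightarrow> degree h \<le> degree g"
    using exists_minimal_degree[of f Zz] f(2) by metis
  obtain a q where aq: "a \<in> S - {0}" "q \<in> polys" "[:a:] * f = q * h"
    using minimal_degree_generates[OF Zz h h_min f_Zz] by blast
  have "degree f \<le> degree h"
  proof (rule ccontr)
    assume "\<not> degree f \<le> degree h"
    then have "poly h c \<noteq> 0"
      using f_min[of h] h by (auto simp: Zc_def Zz_def)
    moreover have "poly q c * poly h c = poly ([:a:] * f) c"
      by (simp only: aq(3) poly_mult)
    ultimately have "q \<in> Zc"
      using aq f by (auto simp: Zc_def)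
    moreover have "q \<noteq> 0"
      using aq f(2) by auto
    ultimately have "degree f \<le> degree q"
      by (rule f_min)
    moreover have "degree f = degree q + degree h"
      using arg_cong[OF aq(3), of degree] aq(1) h(2) \<open>q \<noteq> 0\<close> by (simp add: degree_mult_eq)
    ultimately obtain b where "h = [:b:]"
      by (auto elim: degree_eq_zeroE[of h])
    then show False
      using h coeff_closed[of h 0] by (auto simp: Zz_def \<sigma>p_const \<sigma>_eq_0_iff)
  qed
  then have f_min_Zz: "degree f \<le> degree g" if "g \<in> Zz" "g \<noteq> 0" for g
    using h_min[OF that] by simp
  have "poly (\<sigma>p g) z = 0 \<longleftrightarrow> poly g c = 0" if g: "g \<in> polys" for g
  proof
    assume "poly (\<sigma>p g) z = 0"
    then have "g \<in> Zz"
      using g by (simp add: Zz_def)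
    then obtain b r where br: "b \<in> S - {0}" "[:b:] * g = r * f"
      using minimal_degree_generates[OF Zz f_Zz f(2) f_min_Zz] by blast
    have "b * poly g c = poly r c * poly f c"
      using arg_cong[OF br(2), of "\<lambda>p. poly p c"] by simp
    then show "poly g c = 0"
      using f br(1) by (simp add: Zc_def)
  next
    assume "poly g c = 0"
    then have "g \<in> Zc"
      using g by (simp add: Zc_def)
    then obtain b r where br: "b \<in> S - {0}" "r \<in> polys" "[:b:] * g = r * f"
      using minimal_degree_generates[OF Zc f f_min] by blast
    have "\<sigma>p [:b:] * \<sigma>p g = \<sigma>p r * \<sigma>p f"
      using br f g Zc(1) by (subst (1 2) \<sigma>p_mult[symmetric]) (auto intro: polys_const)
    from arg_cong[OF this, of "\<lambda>p. poly p z"] show "poly (\<sigma>p g) z = 0"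
      using z br(1) by (auto simp: \<sigma>p_const \<sigma>_eq_0_iff)
  qed
  then show ?thesis
    by (intro exI[of _ z] ballI)
qed

lemma countable_polys:
  assumes "countable S"
  shows "countable polys"
proof -
  have "polys \<subseteq> Poly ` lists S"
  proof
    fix g assume "g \<in> polys"
    then have "set (coeffs g) \<subseteq> S"
      by (auto simp: coeffs_def coeff_closed)
    then show "g \<in> Poly ` lists S"
      by (intro image_eqI[of _ _ "coeffs g"]) auto
  qed
  then show ?thesis
    using assms by (rule countable_subset[OF _ countable_image[OF countable_lists]])
qed

text \<open>
  For transcendental \<open>c\<close> the point \<open>z\<close> must avoid the roots of countably many nonzero polynomials;
  this is where countability of \<open>S\<close> enters.
\<close>
lemma conjugate_exists:
  assumes S: "countable S"
  shows "\<exists>z. \<forall>g\<in>polys. poly (\<sigma>p g) z = 0 \<longleftrightarrow> poly g c = 0"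
proof (cases "\<exists>f\<in>polys. f \<noteq> 0 \<and> poly f c = 0")
  case True
  then obtain f where "f \<in> polys" "f \<noteq> 0" "poly f c = 0"
    by auto
  then show ?thesis
    by (rule conjugate_of_algebraic)
next
  case False
  define Z where "Z = (\<Union>g\<in>polys - {0}. {z. poly (\<sigma>p g) z = 0})"
  have "countable {z. poly (\<sigma>p g) z = 0}" if "g \<in> polys - {0}" for g
    using that by (intro countable_finite poly_roots_finite) (simp add: \<sigma>p_eq_0_iff)
  then have "countable Z"
    unfolding Z_def using countable_polys[OF S] by (intro countable_UN) auto
  then have "Z \<noteq> UNIV"
    using uncountable_UNIV_complex by blast
  then obtain z where z: "z \<notin> Z"
    by blast
  have "poly (\<sigma>p g) z = 0 \<longleftrightarrow> poly g c = 0" if "g \<in> polys" for g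
  proof (cases "g = 0")
    case g: False
    then have "poly (\<sigma>p g) z \<noteq> 0"
      using z that by (auto simp: Z_def)
    then show ?thesis
      using False that g by blast
  qed simp
  then show ?thesis
    by (intro exI[of _ z] ballI)
qed

text \<open>
  The extension to \<open>S[c]\<close> sends \<open>g(c)\<close> to \<open>g(z)\<close>. That \<open>z\<close> and \<open>c\<close> are roots of the same
  polynomials over \<open>S\<close> makes this map both well defined and injective.
\<close>
lemma extend_by_element:
  assumes S: "countable S"
  shows "\<exists>S' \<sigma>'. complex_embedding S' \<sigma>' \<and> countable S' \<and> insert c S \<subseteq> S'"
proof -
  obtain z where "\<forall>g\<in>polys. poly (\<sigma>p g) z = 0 \<longleftrightarrow> poly g c = 0"
    using conjugate_exists[OF S] by (rule exE)
  then have z: "poly (\<sigma>p g) z = 0 \<longleftrightarrow> poly g c = 0" if "g \<in> polys" for g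
    using that by (rule bspec)
  define S' where "S' = (\<lambda>g. poly g c) ` polys"
  define rep where "rep x = (SOME g. g \<in> polys \<and> poly g c = x)" for x
  define \<sigma>' where "\<sigma>' x = poly (\<sigma>p (rep x)) z" for x
  have \<sigma>': "\<sigma>' (poly g c) = poly (\<sigma>p g) z" if g: "g \<in> polys" for g
  proof -
    have "rep (poly g c) \<in> polys \<and> poly (rep (poly g c)) c = poly g c"
      unfolding rep_def by (rule someI[of _ g]) (simp add: g)
    with z[of "rep (poly g c) - g"] g show ?thesis
      by (simp add: \<sigma>'_def polys_diff \<sigma>p_diff)
  qed
  have S'I: "poly g c \<in> S'" if "g \<in> polys" for g
    using that by (auto simp: S'_def)
  have const: "a \<in> S'" if "a \<in> S" for a
    using S'I[OF polys_const[OF that]] by simp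
  have "complex_embedding S' \<sigma>'"
  proof
    show "1 \<in> S'"
      by (rule const[OF one_closed])
    show "\<sigma>' 1 = 1"
      using \<sigma>'[OF polys_const[OF one_closed]] by (simp add: \<sigma>p_const \<sigma>_one)
    fix x y assume "x \<in> S'" "y \<in> S'"
    then obtain g h where gh: "g \<in> polys" "h \<in> polys" "x = poly g c" "y = poly h c"
      by (auto simp: S'_def)
    show "x - y \<in> S'" "x * y \<in> S'"
      using gh S'I[of "g - h"] S'I[of "g * h"] by (simp_all add: polys_diff polys_mult)
    show "\<sigma>' (x - y) = \<sigma>' x - \<sigma>' y" "\<sigma>' (x * y) = \<sigma>' x * \<sigma>' y"
      using gh \<sigma>'[of "g - h"] \<sigma>'[of "g * h"] \<sigma>'[of g] \<sigma>'[of h]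
      by (simp_all add: polys_diff polys_mult \<sigma>p_diff \<sigma>p_mult)
  next
    fix x assume "x \<in> S'" "\<sigma>' x = 0"
    then show "x = 0"
      using z by (auto simp: S'_def \<sigma>')
  qed
  moreover have "countable S'"
    unfolding S'_def using countable_polys[OF S] by simp
  moreover have "c \<in> S'"
    using S'I[OF polys_monom[OF one_closed, of 1]] by (simp add: poly_monom)
  ultimately show ?thesis
    using const by (intro exI[of _ S'] exI[of _ \<sigma>']) auto
qed

end

lemma finite_set_embeds:
  fixes C :: "'k::field_char_0 set"
  assumes "finite C"
  shows "\<exists>S \<sigma>. complex_embedding S \<sigma> \<and> countable S \<and> C \<subseteq> S"
  using assms
proof (induction C)
  case empty
  define \<sigma> :: "'k \<Rightarrow> complex" where "\<sigma> x = of_int (SOME k. x = of_int k)" for x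
  have [simp]: "\<sigma> (of_int k) = of_int k" for k
    by (simp add: \<sigma>_def)
  have "complex_embedding \<int> \<sigma>"
  proof
    show "\<sigma> 1 = 1"
      by (metis \<open>\<And>k. \<sigma> (of_int k) = of_int k\<close> of_int_1)
  qed (auto elim!: Ints_cases simp flip: of_int_diff of_int_mult)
  moreover have "countable (\<int> :: 'k set)"
    by (simp add: Ints_def)
  ultimately show ?case
    by (intro exI[of _ "\<int>"] exI[of _ \<sigma>]) simp
next
  case (insert c C)
  then obtain S \<sigma> where "complex_embedding S \<sigma>" "countable S" "C \<subseteq> S"
    by metis
  then obtain S' \<sigma>' where "complex_embedding S' \<sigma>'" "countable S'" "insert c S \<subseteq> S'"
    using complex_embedding.extend_by_element[of S \<sigma> c] by metis
  with \<open>C \<subseteq> S\<close> show ?case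
    by (intro exI[of _ S'] exI[of _ \<sigma>']) auto
qed

section \<open>Bounded operators do not satisfy the Weyl relation\<close>

context complex_embedding
begin

text \<open>
  The supremum norm, measured through \<open>\<sigma>\<close>, as a relation between functions and upper bounds:
  the bounds of composed operators multiply without any supremum being formed. The condition on
  the values restricts the norm to functions on which \<open>\<sigma>\<close> is meaningful.
\<close>
definition bounded_by :: "('s \<Rightarrow> 'k) \<Rightarrow> real \<Rightarrow> bool" where
  "bounded_by f c \<longleftrightarrow> (\<forall>s. f s \<in> S \<and> cmod (\<sigma> (f s)) \<le> c)"

lemma bounded_by_nonneg: "bounded_by f c \<Longrightarrow> 0 \<le> c"
  using norm_ge_zero order_trans unfolding bounded_by_def by blast

lemma bounded_by_add:
  assumes "bounded_by f c" "bounded_by g d"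
  shows "bounded_by (\<lambda>s. f s + g s) (c + d)"
  using assms unfolding bounded_by_def
  by (auto simp: add_closed \<sigma>_add intro!: norm_triangle_mono)

lemma bounded_by_diff:
  assumes "bounded_by f c" "bounded_by g d"
  shows "bounded_by (\<lambda>s. f s - g s) (c + d)"
proof -
  have "cmod (\<sigma> (f s) - \<sigma> (g s)) \<le> c + d" for s
    using assms norm_triangle_ineq4[of "\<sigma> (f s)" "\<sigma> (g s)"]
    by (smt (verit) bounded_by_def)
  then show ?thesis
    using assms by (auto simp: bounded_by_def diff_closed \<sigma>_diff)
qed

lemma bounded_by_scale:
  assumes "a \<in> S" "bounded_by f c"
  shows "bounded_by (\<lambda>s. a * f s) (cmod (\<sigma> a) * c)"
  using assms by (auto simp: bounded_by_def mult_closed \<sigma>_mult norm_mult mult_left_mono)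

text \<open>
  Wielandt's theorem for operators that are linear over the field but bounded only through \<open>\<sigma>\<close>.
  Fix \<open>k\<close> with \<open>N = k + 1 > 2 \<alpha> \<beta>\<close>. The identity
  \<open>N A\<^sup>k = A (A\<^sup>k B) - B (A A\<^sup>k)\<close> expresses \<open>N A\<^sup>k\<close> by \<open>A\<^sup>k\<close> again, at the cost of a
  factor \<open>2 \<alpha> \<beta>\<close> in the bound; iterating it \<open>j\<close> times bounds \<open>A\<^sup>k f\<close> by a multiple of
  \<open>(2 \<alpha> \<beta> / N)\<^sup>j\<close>, which tends to \<open>0\<close>. So \<open>A\<^sup>k\<close> vanishes on all bounded functions,
  and the commutator identity passes this down to \<open>A\<^sup>0\<close>, which fixes the constant function \<open>1\<close>.
\<close>
lemma no_bounded_canonical_pair: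
  fixes A B :: "('s \<Rightarrow> 'k) \<Rightarrow> ('s \<Rightarrow> 'k)"
  assumes A_linear: "\<And>c f g. A (\<lambda>s. c * f s + g s) = (\<lambda>s. c * A f s + A g s)"
    and B_linear: "\<And>c f g. B (\<lambda>s. c * f s + g s) = (\<lambda>s. c * B f s + B g s)"
    and A_bounded: "\<And>f c. bounded_by f c \<Longrightarrow> bounded_by (A f) (\<alpha> * c)"
    and B_bounded: "\<And>f c. bounded_by f c \<Longrightarrow> bounded_by (B f) (\<beta> * c)"
    and commutator: "\<And>f s. A (B f) s - B (A f) s = f s"
  shows False
proof -
  have scale: "A (\<lambda>s. c * f s) = (\<lambda>s. c * A f s)" "B (\<lambda>s. c * f s) = (\<lambda>s. c * B f s)"
    for c f
  proof -
    have "A (\<lambda>s. 0) = (\<lambda>s. 0)" "B (\<lambda>s. 0) = (\<lambda>s. 0)"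
      using A_linear[of "- 1" "\<lambda>s. 0" "\<lambda>s. 0"] B_linear[of "- 1" "\<lambda>s. 0" "\<lambda>s. 0"] by simp_all
    then show "A (\<lambda>s. c * f s) = (\<lambda>s. c * A f s)" "B (\<lambda>s. c * f s) = (\<lambda>s. c * B f s)"
      using A_linear[of c f "\<lambda>s. 0"] B_linear[of c f "\<lambda>s. 0"] by simp_all
  qed
  \<comment> \<open>The Weyl algebra identity \<open>p\<^sup>k q - q p\<^sup>k = k p\<^sup>k\<^sup>-\<^sup>1\<close>, shifted by one to avoid
    \<open>k = 0\<close>.\<close>
  have power_commutator:
    "(A ^^ Suc k) (B f) = (\<lambda>s. of_nat (Suc k) * (A ^^ k) f s + B ((A ^^ Suc k) f) s)" for k f
  proof (induction k)
    case 0
    show ?case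
      using commutator[of f] by (auto simp: algebra_simps)
  next
    case (Suc k)
    let ?g = "(A ^^ Suc k) f"
    have "(A ^^ Suc (Suc k)) (B f) = A (\<lambda>s. of_nat (Suc k) * (A ^^ k) f s + B ?g s)"
      by (subst Suc[symmetric]) simp
    also have "\<dots> = (\<lambda>s. of_nat (Suc k) * ?g s + A (B ?g) s)"
      unfolding A_linear by simp
    also have "A (B ?g) = (\<lambda>s. ?g s + B (A ?g) s)"
      using commutator[of ?g] by (auto simp: algebra_simps)
    finally show ?case
      by (simp add: algebra_simps)
  qed
  have "bounded_by (\<lambda>s. 1) 1"
    by (simp add: bounded_by_def one_closed \<sigma>_one)
  then have nonneg: "0 \<le> \<alpha>" "0 \<le> \<beta>"
    using A_bounded B_bounded bounded_by_nonneg by fastforce+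
  have power_bounded: "bounded_by ((A ^^ k) f) (\<alpha> ^ k * c)" if "bounded_by f c" for k f c
  proof (induction k)
    case (Suc k)
    then show ?case
      using A_bounded by (auto simp: mult.assoc)
  qed (use that in simp)
  obtain k where k: "2 * \<alpha> * \<beta> < real (Suc k)"
    using reals_Archimedean2[of "2 * \<alpha> * \<beta>"] by (meson less_trans lessI of_nat_less_iff)
  define N where "N = Suc k"
  have iterated: "bounded_by (\<lambda>s. of_nat N ^ j * (A ^^ k) f s) ((2 * \<alpha> * \<beta>) ^ j * (\<alpha> ^ k * c))"
    if "bounded_by f c" for j f c
    using that
  proof (induction j arbitrary: f c)
    case 0
    then show ?case
      using power_bounded by simp
  next
    case (Suc j)
    let ?F = "\<lambda>f s. of_nat N ^ j * (A ^^ k) f s"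
    have recursion: "of_nat N ^ Suc j * (A ^^ k) f s = A (?F (B f)) s - B (A (?F f)) s" for s
    proof -
      have "of_nat N * (A ^^ k) f s = (A ^^ Suc k) (B f) s - B ((A ^^ Suc k) f) s"
        unfolding power_commutator N_def by simp
      then show ?thesis
        by (simp add: scale power_Suc2 mult.assoc right_diff_distrib del: power_Suc)
    qed
    let ?d = "(2 * \<alpha> * \<beta>) ^ j * (\<alpha> ^ k * c)"
    have "bounded_by (\<lambda>s. A (?F (B f)) s - B (A (?F f)) s)
        (\<alpha> * ((2 * \<alpha> * \<beta>) ^ j * (\<alpha> ^ k * (\<beta> * c))) + \<beta> * (\<alpha> * ?d))"
      by (intro bounded_by_diff A_bounded B_bounded Suc.IH Suc.prems)
    also have "\<alpha> * ((2 * \<alpha> * \<beta>) ^ j * (\<alpha> ^ k * (\<beta> * c))) + \<beta> * (\<alpha> * ?d) =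
        (2 * \<alpha> * \<beta>) ^ Suc j * (\<alpha> ^ k * c)"
      by (simp add: algebra_simps)
    finally show ?case
      unfolding recursion .
  qed
  have vanish: "\<sigma> ((A ^^ k) f s) = 0" if f: "bounded_by f c" for f c s
  proof -
    define v where "v = cmod (\<sigma> ((A ^^ k) f s))"
    have S_mem: "(A ^^ k) f s \<in> S"
      using power_bounded[OF f] by (simp add: bounded_by_def)
    have "v \<le> (2 * \<alpha> * \<beta> / real N) ^ j * (\<alpha> ^ k * c)" for j
    proof -
      have "real N ^ j * v = cmod (\<sigma> (of_nat (N ^ j) * (A ^^ k) f s))"
        unfolding v_def
        by (simp add: \<sigma>_mult of_nat_closed S_mem \<sigma>_of_nat norm_mult flip: of_nat_power)
      also have "\<dots> \<le> (2 * \<alpha> * \<beta>) ^ j * (\<alpha> ^ k * c)"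
        using iterated[OF f, of j] by (simp add: bounded_by_def)
      finally show ?thesis
        by (simp add: N_def field_simps)
    qed
    moreover have "(\<lambda>j. (2 * \<alpha> * \<beta> / real N) ^ j * (\<alpha> ^ k * c)) \<longlonglongrightarrow> 0 * (\<alpha> ^ k * c)"
      using k nonneg by (intro tendsto_mult LIMSEQ_power_zero tendsto_const) (simp add: N_def)
    ultimately have "v \<le> 0"
      by (intro LIMSEQ_le_const[where X = "\<lambda>j. (2 * \<alpha> * \<beta> / real N) ^ j * (\<alpha> ^ k * c)"]) auto
    then show ?thesis
      by (simp add: v_def)
  qed
  have descent: "bounded_by ((A ^^ i) f) 0" if "i \<le> k" "bounded_by f c" for i f c
    using that
  proof (induction i arbitrary: f c rule: inc_induct)
    case base
    then show ?case
      using vanish power_bounded[of f c k] by (auto simp: bounded_by_def)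
  next
    case (step i)
    have "bounded_by (\<lambda>s. (A ^^ Suc i) (B f) s - B ((A ^^ Suc i) f) s) (0 + \<beta> * 0)"
      by (intro bounded_by_diff B_bounded step.IH[OF step.prems] step.IH[OF B_bounded[OF step.prems]])
    then have "bounded_by (\<lambda>s. of_nat (Suc i) * (A ^^ i) f s) 0"
      unfolding power_commutator by simp
    then have "\<sigma> (of_nat (Suc i) * (A ^^ i) f s) = 0" for s
      by (simp only: bounded_by_def norm_le_zero_iff)
    moreover have "(A ^^ i) f s \<in> S" for s
      using power_bounded[OF step.prems] by (simp add: bounded_by_def)
    ultimately show ?case
      by (simp add: bounded_by_def \<sigma>_mult of_nat_closed \<sigma>_of_nat del: of_nat_Suc)
  qed
  show False
    using descent[of 0 "\<lambda>s. 1" 1] \<open>bounded_by (\<lambda>s. 1) 1\<close>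
    by (simp add: bounded_by_def \<sigma>_one)
qed

end

section \<open>Actions of free algebras on function spaces\<close>

lemma nc_poly_induct [case_names zero add]:
  fixes p :: "('g, 'k::field) nc_poly"
  assumes "P 0" and "\<And>p w c. P p \<Longrightarrow> P (p + Poly_Mapping.single w c)"
  shows "P p"
proof (induction p rule: update_induct)
  case (update f a b)
  have "Poly_Mapping.update a b f = f + Poly_Mapping.single a b"
    using update.hyps(1)
    by (intro poly_mapping_eqI)
       (auto simp: lookup_update lookup_add lookup_single when_def in_keys_iff)
  with assms(2)[OF update.IH] show ?case
    by simp
qed (use assms in simp)

text \<open>
  By the universal property of the free algebra, the generators may act by arbitrary linear
  operators; a word acts by the composite of its letters.
\<close>
locale free_algebra_action =
  fixes \<rho> :: "'g \<Rightarrow> ('s \<Rightarrow> 'k::field) \<Rightarrow> ('s \<Rightarrow> 'k)"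
  assumes linear: "\<rho> g (\<lambda>s. c * f s + h s) = (\<lambda>s. c * \<rho> g f s + \<rho> g h s)"
begin

definition word_op :: "'g word \<Rightarrow> ('s \<Rightarrow> 'k) \<Rightarrow> ('s \<Rightarrow> 'k)" where
  "word_op w = foldr \<rho> (letters w)"

definition poly_op :: "('g, 'k) nc_poly \<Rightarrow> ('s \<Rightarrow> 'k) \<Rightarrow> ('s \<Rightarrow> 'k)" where
  "poly_op p f s = (\<Sum>w\<in>Poly_Mapping.keys p. Poly_Mapping.lookup p w * word_op w f s)"

lemma word_op_linear: "word_op w (\<lambda>s. c * f s + h s) = (\<lambda>s. c * word_op w f s + word_op w h s)"
proof -
  have "foldr \<rho> gs (\<lambda>s. c * f s + h s) = (\<lambda>s. c * foldr \<rho> gs f s + foldr \<rho> gs h s)" for gs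
    by (induction gs) (simp_all add: linear)
  then show ?thesis
    by (simp add: word_op_def)
qed

lemma word_op_zero: "word_op w (\<lambda>s. 0) = (\<lambda>s. 0)"
  using word_op_linear[of w "- 1" "\<lambda>s. 0" "\<lambda>s. 0"] by simp

lemma word_op_plus: "word_op (u + v) f = word_op u (word_op v f)"
  by (simp add: word_op_def)

lemma poly_op_superset:
  assumes "finite W" "Poly_Mapping.keys p \<subseteq> W"
  shows "poly_op p f s = (\<Sum>w\<in>W. Poly_Mapping.lookup p w * word_op w f s)"
  unfolding poly_op_def using assms by (intro sum.mono_neutral_left) (auto simp: in_keys_iff)

lemma poly_op_add: "poly_op (p + q) f s = poly_op p f s + poly_op q f s"
proof -
  let ?W = "Poly_Mapping.keys p \<union> Poly_Mapping.keys q"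
  show ?thesis
    using poly_op_superset[of ?W "p + q"] poly_op_superset[of ?W p] poly_op_superset[of ?W q]
      keys_add[of p q]
    by (simp add: lookup_add distrib_right sum.distrib)
qed

lemma poly_op_zero: "poly_op 0 f s = 0"
  by (simp add: poly_op_def)

lemma poly_op_diff: "poly_op (p - q) f s = poly_op p f s - poly_op q f s"
  using poly_op_add[of "p - q" q f s] by simp

lemma poly_op_sum: "poly_op (\<Sum>i\<in>I. p i) f s = (\<Sum>i\<in>I. poly_op (p i) f s)"
  by (induction I rule: infinite_finite_induct) (simp_all add: poly_op_zero poly_op_add)

lemma poly_op_single: "poly_op (Poly_Mapping.single w c) f s = c * word_op w f s"
  by (simp add: poly_op_superset[of "{w}"])

lemma poly_op_one: "poly_op 1 f s = f s"
  using poly_op_single[of 0 1] by (simp add: word_op_def)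

lemma poly_op_gen: "poly_op (gen g) f = \<rho> g f"
  by (auto simp: gen_def poly_op_single word_op_def)

lemma poly_op_linear: "poly_op p (\<lambda>s. c * f s + h s) = (\<lambda>s. c * poly_op p f s + poly_op p h s)"
  by (intro ext) (simp add: poly_op_def word_op_linear distrib_left mult.left_commute
    sum.distrib sum_distrib_left)

lemma poly_op_mult: "poly_op (p * q) f s = poly_op p (poly_op q f) s"
proof -
  have single: "poly_op (Poly_Mapping.single u c * q) f s = c * word_op u (poly_op q f) s" for u c s
  proof (induction q arbitrary: s rule: nc_poly_induct)
    case zero
    have "poly_op 0 f = (\<lambda>s. 0)"
      by (auto simp: poly_op_zero)
    then show ?case
      by (simp add: poly_op_zero word_op_zero)
  next
    case (add q v d)
    have "poly_op (q + Poly_Mapping.single v d) f = (\<lambda>s. d * word_op v f s + poly_op q f s)"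
      by (auto simp: poly_op_add poly_op_single)
    with add show ?case
      by (simp add: distrib_left poly_op_add mult_single poly_op_single word_op_linear word_op_plus)
  qed
  show ?thesis
    by (induction p rule: nc_poly_induct)
       (simp_all add: poly_op_zero distrib_right poly_op_add single poly_op_single)
qed

lemma annihilator_ideal:
  "ideal {p \<in> carrier (free_algebra X). \<forall>f s. poly_op p f s = 0} (free_algebra X)"
proof (rule idealI)
  interpret F: ring "free_algebra X :: ('k, ('g, 'k) nc_poly) module"
    by (rule ring_free_algebra)
  show "ring (free_algebra X :: ('k, ('g, 'k) nc_poly) module)"
    by (rule ring_free_algebra)
  let ?K = "{p \<in> carrier (free_algebra X). \<forall>f s. poly_op p f s = 0}"
  show "subgroup ?K (add_monoid (free_algebra X))"
  proof (rule F.add.subgroupI)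
    show "?K \<noteq> {}"
      using free_algebra_zero poly_op_zero by blast
    fix p assume p: "p \<in> ?K"
    have "- p \<in> ?K"
      using p poly_op_diff[of 0 p] by (simp add: poly_op_zero free_algebra_uminus)
    moreover have "\<ominus>\<^bsub>free_algebra X\<^esub> p = - p"
      using p by (intro F.minus_equality) (auto simp: free_algebra_uminus)
    ultimately show "\<ominus>\<^bsub>free_algebra X\<^esub> p \<in> ?K"
      by simp
  qed (auto simp: free_algebra_add poly_op_add)
  fix p q :: "('g, 'k) nc_poly" assume p: "p \<in> ?K" and q: "q \<in> carrier (free_algebra X)"
  have "word_op w (poly_op p f) s = 0" for w f s
  proof -
    have "poly_op p f = (\<lambda>s. 0)"
      using p by auto
    then show ?thesis
      by (simp add: word_op_zero)
  qed
  then have "poly_op q (poly_op p f) s = 0" for f s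
    by (simp add: poly_op_def[of q])
  then show "q \<otimes>\<^bsub>free_algebra X\<^esub> p \<in> ?K"
    using p q by (simp add: free_algebra_mult poly_op_mult)
  show "p \<otimes>\<^bsub>free_algebra X\<^esub> q \<in> ?K"
    using p q by (simp add: free_algebra_mult poly_op_mult)
qed

text \<open>
  The annihilator of an action is an ideal, so an action that kills the relations factors through
  the presented algebra.
\<close>
lemma genideal_annihilates:
  assumes R: "R \<subseteq> carrier (free_algebra X)" and ann: "\<And>r f s. r \<in> R \<Longrightarrow> poly_op r f s = 0"
    and p: "p \<in> Idl\<^bsub>free_algebra X\<^esub> R"
  shows "poly_op p f s = 0"
proof -
  interpret F: ring "free_algebra X :: ('k, ('g, 'k) nc_poly) module"
    by (rule ring_free_algebra)
  have "Idl\<^bsub>free_algebra X\<^esub> R \<subseteq> {p \<in> carrier (free_algebra X). \<forall>f s. poly_op p f s = 0}"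
    using R ann by (intro F.genideal_minimal annihilator_ideal) auto
  then show ?thesis
    using p by auto
qed

end

lemma (in complex_embedding) bounded_by_sum:
  assumes "\<And>i. i \<in> I \<Longrightarrow> bounded_by (f i) (c i)"
  shows "bounded_by (\<lambda>s. \<Sum>i\<in>I. f i s) (\<Sum>i\<in>I. c i)"
  using assms
proof (induction I rule: infinite_finite_induct)
  case (insert i I)
  then show ?case
    by (simp add: bounded_by_add)
qed (simp_all add: bounded_by_def zero_closed \<sigma>_zero)

lemma (in complex_embedding) poly_op_bounded:
  fixes \<rho> :: "'g \<Rightarrow> ('s \<Rightarrow> 'k) \<Rightarrow> ('s \<Rightarrow> 'k)"
  assumes "free_algebra_action \<rho>"
    and contraction: "\<And>g f c. bounded_by f c \<Longrightarrow> bounded_by (\<rho> g f) c"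
    and coeffs: "\<And>w. w \<in> Poly_Mapping.keys p \<Longrightarrow> Poly_Mapping.lookup p w \<in> S"
    and f: "bounded_by f c"
  shows "bounded_by (free_algebra_action.poly_op \<rho> p f)
           ((\<Sum>w\<in>Poly_Mapping.keys p. cmod (\<sigma> (Poly_Mapping.lookup p w))) * c)"
proof -
  interpret free_algebra_action \<rho> by fact
  have "bounded_by (foldr \<rho> gs f) c" for gs
    by (induction gs) (simp_all add: f contraction)
  then have "bounded_by (word_op w f) c" for w
    by (simp add: word_op_def)
  then show ?thesis
    unfolding poly_op_def[abs_def] sum_distrib_right
    by (intro bounded_by_sum bounded_by_scale coeffs)
qed

section \<open>The shift representation of the Leavitt algebra\<close>

text \<open>
  The block in row \<open>i\<close> and column \<open>j\<close> of the operator \<open>F \<mapsto> F \<circ> \<chi>\<close>, where a tuple of functions on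
  \<open>\<nat>\<close>, indexed by \<open>j\<close>, is read as one function \<open>F\<close> on pairs.
\<close>
definition shift :: "(nat \<times> nat \<Rightarrow> nat \<times> nat) \<Rightarrow> nat \<Rightarrow> nat \<Rightarrow> (nat \<Rightarrow> 'k::field) \<Rightarrow> (nat \<Rightarrow> 'k)" where
  "shift \<chi> i j f s = (if snd (\<chi> (s, i)) = j then f (fst (\<chi> (s, i))) else 0)"

lemma shift_linear: "shift \<chi> i j (\<lambda>s. c * f s + h s) = (\<lambda>s. c * shift \<chi> i j f s + shift \<chi> i j h s)"
  by (auto simp: shift_def)

lemma (in complex_embedding) shift_bounded:
  assumes f: "bounded_by f c"
  shows "bounded_by (shift \<chi> i j f) c"
  using f bounded_by_nonneg[OF f] by (auto simp: bounded_by_def shift_def zero_closed \<sigma>_zero)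

text \<open>
  The matrix product of the blocks of \<open>\<chi>\<close> with those of an inverse of \<open>\<chi>\<close> is the identity matrix:
  of the summands only the one with \<open>j\<close> equal to the second component of \<open>\<chi> (s, i)\<close> survives.
\<close>
lemma sum_shift_shift:
  assumes "\<chi> (s, i) \<in> UNIV \<times> J" "finite J" "\<chi>' (\<chi> (s, i)) = (s, i)"
  shows "(\<Sum>j\<in>J. shift \<chi> i j (shift \<chi>' j k f) s) = (if i = k then f s else 0)"
proof -
  obtain t l where tl: "\<chi> (s, i) = (t, l)" "l \<in> J"
    using assms(1) by auto
  have "(\<Sum>j\<in>J. shift \<chi> i j (shift \<chi>' j k f) s) = (\<Sum>j\<in>J. if l = j then shift \<chi>' j k f t else 0)"
    by (intro sum.cong) (simp_all add: shift_def[of \<chi>] tl)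
  also have "\<dots> = shift \<chi>' l k f t"
    using assms(2) tl(2) by simp
  also have "\<dots> = (if i = k then f s else 0)"
    using assms(3) by (simp add: tl shift_def)
  finally show ?thesis .
qed

fun leavitt_shift :: "(nat \<times> nat \<Rightarrow> nat \<times> nat) \<Rightarrow> (nat \<times> nat \<Rightarrow> nat \<times> nat) \<Rightarrow>
    leavitt_gen \<Rightarrow> (nat \<Rightarrow> 'k::field) \<Rightarrow> (nat \<Rightarrow> 'k)" where
  "leavitt_shift \<psi> \<psi>' (LX i j) = shift \<psi> i j"
| "leavitt_shift \<psi> \<psi>' (LY j i) = shift \<psi>' j i"

lemma leavitt_shift_action:
  "free_algebra_action (leavitt_shift \<psi> \<psi>' :: _ \<Rightarrow> (nat \<Rightarrow> 'k::field) \<Rightarrow> _)"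
proof
  fix g :: leavitt_gen and c :: 'k and f h :: "nat \<Rightarrow> 'k"
  show "leavitt_shift \<psi> \<psi>' g (\<lambda>s. c * f s + h s) =
      (\<lambda>s. c * leavitt_shift \<psi> \<psi>' g f s + leavitt_shift \<psi> \<psi>' g h s)"
    by (cases g) (simp_all add: shift_linear)
qed

lemma exists_bijection:
  assumes "0 < m" "0 < n"
  shows "\<exists>\<psi>. bij_betw \<psi> ((UNIV :: nat set) \<times> {1..m::nat}) ((UNIV :: nat set) \<times> {1..n::nat})"
proof -
  have "bij_betw (to_nat_on ((UNIV :: nat set) \<times> {1..k})) (UNIV \<times> {1..k}) UNIV" if "0 < k" for k :: nat
    using that by (intro to_nat_on_infinite) (auto simp: finite_cartesian_product_iff)
  then show ?thesis
    using assms bij_betw_trans bij_betw_inv_into by meson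
qed

lemma leavitt_rels_annihilate:
  assumes bij: "bij_betw \<psi> (UNIV \<times> {1..m}) (UNIV \<times> {1..n})"
    and inv: "\<psi>' = inv_into (UNIV \<times> {1..m}) \<psi>"
    and r: "r \<in> leavitt_rels m n"
  shows "free_algebra_action.poly_op (leavitt_shift \<psi> \<psi>') r f s = 0"
proof -
  interpret free_algebra_action "leavitt_shift \<psi> \<psi>' :: leavitt_gen \<Rightarrow> (nat \<Rightarrow> 'a) \<Rightarrow> _"
    by (rule leavitt_shift_action)
  have \<psi>: "\<psi> (s, i) \<in> UNIV \<times> {1..n}" "\<psi>' (\<psi> (s, i)) = (s, i)" if "i \<in> {1..m}" for s i
    using bij bij_betwE[OF bij] that by (auto simp: inv bij_betw_inv_into_left)
  have \<psi>': "\<psi>' (t, j) \<in> UNIV \<times> {1..m}" "\<psi> (\<psi>' (t, j)) = (t, j)" if "j \<in> {1..n}" for t j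
    using bij_betwE[OF bij_betw_inv_into[OF bij]] bij_betw_inv_into_right[OF bij, of "(t, j)"] that
    by (auto simp: inv)
  from r consider
    i k where "i \<in> {1..m}" "r = (\<Sum>j = 1..n. gen (LX i j) * gen (LY j k)) - (if i = k then 1 else 0)"
  | j l where "j \<in> {1..n}" "r = (\<Sum>i = 1..m. gen (LY j i) * gen (LX i l)) - (if j = l then 1 else 0)"
    by (auto simp: leavitt_rels_def)
  then show ?thesis
  proof cases
    case 1
    have "(\<Sum>j = 1..n. shift \<psi> i j (shift \<psi>' j k f) s) = (if i = k then f s else 0)"
      using 1(1) by (intro sum_shift_shift \<psi>) simp_all
    with 1(2) show ?thesis
      by (simp add: poly_op_diff poly_op_sum poly_op_mult poly_op_gen poly_op_one poly_op_zero)
  next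
    case 2
    have "(\<Sum>i = 1..m. shift \<psi>' j i (shift \<psi> i l f) s) = (if j = l then f s else 0)"
      using 2(1) by (intro sum_shift_shift \<psi>') simp_all
    with 2(2) show ?thesis
      by (simp add: poly_op_diff poly_op_sum poly_op_mult poly_op_gen poly_op_one poly_op_zero)
  qed
qed

section \<open>Homomorphisms from the Weyl algebra into a presented algebra\<close>

context
  fixes X :: "'g set" and R :: "('g, 'k::field) nc_poly set"
  assumes rels: "R \<subseteq> carrier (free_algebra X)"
begin

interpretation F: ring "free_algebra X :: ('k, ('g, 'k) nc_poly) module"
  by (rule ring_free_algebra)

interpretation I: ideal "Idl\<^bsub>free_algebra X\<^esub> R" "free_algebra X"
  by (rule F.genideal_ideal[OF rels])

abbreviation cls :: "('g, 'k) nc_poly \<Rightarrow> ('g, 'k) nc_poly set" where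
  "cls p \<equiv> Idl\<^bsub>free_algebra X\<^esub> R +>\<^bsub>free_algebra X\<^esub> p"

lemma cls_hom: "cls \<in> ring_hom (free_algebra X) (presented_algebra X R)"
  using I.rcos_ring_hom by (simp add: ring_hom_def presented_algebra_def)

lemma carrier_presented_algebra: "carrier (presented_algebra X R) = cls ` carrier (free_algebra X)"
  by (auto simp: presented_algebra_def FactRing_def A_RCOSETS_def')

lemma cls_eq_iff:
  assumes "p \<in> carrier (free_algebra X)" "q \<in> carrier (free_algebra X)"
  shows "cls p = cls q \<longleftrightarrow> p - q \<in> Idl\<^bsub>free_algebra X\<^esub> R"
proof
  assume "cls p = cls q"
  then have "p \<in> cls q"
    using I.a_rcos_self[OF assms(1)] by simp
  then show "p - q \<in> Idl\<^bsub>free_algebra X\<^esub> R"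
    by (auto simp: a_r_coset_def')
next
  assume "p - q \<in> Idl\<^bsub>free_algebra X\<^esub> R"
  then have "p \<in> cls q"
    unfolding a_r_coset_def' by (auto intro: bexI[of _ "p - q"])
  then show "cls p = cls q"
    using I.a_repr_independence'[OF _ assms(2)] by simp
qed

end

text \<open>
  Here \<open>p\<close> and \<open>q\<close> represent the images of the two Weyl generators. The lemma moves the problem
  from cosets to elements of the free algebra, where operators and coefficients are available.
\<close>
lemma weyl_hom_commutator:
  fixes R :: "('g, 'k::field) nc_poly set" and \<phi> :: "'k weyl \<Rightarrow> _"
  assumes h: "\<phi> \<in> ring_hom weyl_algebra (presented_algebra X R)"
    and R: "R \<subseteq> carrier (free_algebra X)"
  shows "\<exists>p\<in>carrier (free_algebra X). \<exists>q\<in>carrier (free_algebra X).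
           p * q - (q * p + 1) \<in> Idl\<^bsub>free_algebra X\<^esub> R"
proof -
  let ?W = "free_algebra {WX, WY} :: ('k, (weyl_gen, 'k) nc_poly) module" and ?F = "free_algebra X"
  let ?x = "gen WX :: (weyl_gen, 'k) nc_poly" and ?y = "gen WY :: (weyl_gen, 'k) nc_poly"
  let ?w = "cls {WX, WY} {?x * ?y - ?y * ?x - 1}" and ?l = "cls X R"
  note w_hom = cls_hom[OF weyl_rel_closed, folded weyl_algebra_def]
  note l_hom = cls_hom[OF R]
  interpret W: ring ?W
    by (rule ring_free_algebra)
  have gens: "?x \<in> carrier ?W" "?y \<in> carrier ?W" "1 \<in> carrier ?W"
    by (auto intro: free_algebra_closed)
  have "?x * ?y - (?y * ?x + 1) \<in>
      Idl\<^bsub>?W\<^esub> {?x * ?y - ?y * ?x - 1}"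
    using W.genideal_self'[of "?x * ?y - ?y * ?x - 1"] weyl_rel_closed
    by (simp add: diff_diff_eq)
  then have "?w (?x * ?y) = ?w (?y * ?x + 1)"
    using gens by (subst cls_eq_iff[OF weyl_rel_closed]) (auto intro!: free_algebra_closed)
  then have rel: "?w (?x) \<otimes>\<^bsub>weyl_algebra\<^esub> ?w (?y) =
      ?w (?y) \<otimes>\<^bsub>weyl_algebra\<^esub> ?w (?x) \<oplus>\<^bsub>weyl_algebra\<^esub> \<one>\<^bsub>weyl_algebra\<^esub>"
  proof -
    have "?w (?x * ?y) = ?w ?x \<otimes>\<^bsub>weyl_algebra\<^esub> ?w ?y"
      using ring_hom_mult[OF w_hom gens(1,2)] by simp
    moreover have "?w (?y * ?x) = ?w ?y \<otimes>\<^bsub>weyl_algebra\<^esub> ?w ?x"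
      using ring_hom_mult[OF w_hom gens(2,1)] by simp
    moreover have "?w (?y * ?x + 1) = ?w (?y * ?x) \<oplus>\<^bsub>weyl_algebra\<^esub> ?w 1"
      using ring_hom_add[OF w_hom, of "?y * ?x" 1] gens by (simp add: free_algebra_mult)
    moreover have "?w 1 = \<one>\<^bsub>weyl_algebra\<^esub>"
      using ring_hom_one[OF w_hom] by simp
    ultimately show ?thesis
      using \<open>?w (?x * ?y) = ?w (?y * ?x + 1)\<close> by (simp only:)
  qed
  interpret WA: ring weyl_algebra
    unfolding weyl_algebra_def by (rule ring_presented_algebra[OF weyl_rel_closed])
  have mem: "?w (?x) \<in> carrier weyl_algebra" "?w (?y) \<in> carrier weyl_algebra"
    using gens ring_hom_closed[OF w_hom] by auto
  obtain p q where pq: "p \<in> carrier ?F" "q \<in> carrier ?F" "\<phi> (?w (?x)) = ?l p" "\<phi> (?w (?y)) = ?l q"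
    using ring_hom_closed[OF h mem(1)] ring_hom_closed[OF h mem(2)]
    unfolding carrier_presented_algebra[OF R] by blast
  have "?l (p * q) = ?l (q * p + 1)"
  proof -
    have "?l (p * q) = \<phi> (?w (?x) \<otimes>\<^bsub>weyl_algebra\<^esub> ?w (?y))"
      using pq mem ring_hom_mult[OF h] ring_hom_mult[OF l_hom, of p q] by simp
    also have "\<dots> = ?l (q * p + 1)"
      unfolding rel using pq mem ring_hom_mult[OF h] ring_hom_add[OF h] ring_hom_one[OF h]
        ring_hom_mult[OF l_hom, of q p] ring_hom_add[OF l_hom, of "q * p" 1] ring_hom_one[OF l_hom]
      by (simp add: free_algebra_mult free_algebra_one)
    finally show ?thesis .
  qed
  then have "p * q - (q * p + 1) \<in> Idl\<^bsub>?F\<^esub> R"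
    using pq by (subst (asm) cls_eq_iff[OF R]) (auto intro!: free_algebra_closed)
  then show ?thesis
    using pq by blast
qed

section \<open>The Weyl algebra does not embed into a Leavitt algebra\<close>

theorem theorem3p7:
  fixes m n :: nat
  assumes "0 < m" and "m < n"
  shows "\<not> (\<exists>\<phi> :: 'k::field_char_0 weyl \<Rightarrow> 'k leavitt.
            \<phi> \<in> algebra_hom weyl_algebra (leavitt_algebra m n) \<and>
            inj_on \<phi> (carrier weyl_algebra))"
proof
  let ?F = "free_algebra (leavitt_gens m n) :: ('k, (leavitt_gen, 'k) nc_poly) module"
  assume "\<exists>\<phi> :: 'k weyl \<Rightarrow> 'k leavitt.
            \<phi> \<in> algebra_hom weyl_algebra (leavitt_algebra m n) \<and>
            inj_on \<phi> (carrier weyl_algebra)"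
  then obtain \<phi> :: "'k weyl \<Rightarrow> 'k leavitt"
    where "\<phi> \<in> ring_hom weyl_algebra (presented_algebra (leavitt_gens m n) (leavitt_rels m n))"
    by (auto simp: algebra_hom_def leavitt_algebra_def)
  then obtain p q :: "(leavitt_gen, 'k) nc_poly"
    where pq: "p * q - (q * p + 1) \<in> Idl\<^bsub>?F\<^esub> (leavitt_rels m n)"
    using weyl_hom_commutator[OF _ leavitt_rels_closed] by blast
  obtain \<psi> where \<psi>: "bij_betw \<psi> ((UNIV :: nat set) \<times> {1..m}) ((UNIV :: nat set) \<times> {1..n})"
    using exists_bijection[of m n] assms by auto
  define \<rho> :: "leavitt_gen \<Rightarrow> (nat \<Rightarrow> 'k) \<Rightarrow> (nat \<Rightarrow> 'k)"
    where "\<rho> = leavitt_shift \<psi> (inv_into (UNIV \<times> {1..m}) \<psi>)"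
  have action: "free_algebra_action \<rho>"
    unfolding \<rho>_def by (rule leavitt_shift_action)
  interpret free_algebra_action \<rho>
    by (rule action)
  have "poly_op (p * q - (q * p + 1)) f s = 0" for f s
    using genideal_annihilates[OF leavitt_rels_closed _ pq] leavitt_rels_annihilate[OF \<psi> refl]
    unfolding \<rho>_def by blast
  then have commutator: "poly_op p (poly_op q f) s - poly_op q (poly_op p f) s = f s" for f s
    by (simp add: poly_op_diff poly_op_add poly_op_mult poly_op_one algebra_simps)
  define C where "C =
    Poly_Mapping.lookup p ` Poly_Mapping.keys p \<union> Poly_Mapping.lookup q ` Poly_Mapping.keys q"
  have "finite C"
    by (simp add: C_def)
  then obtain S and \<sigma> :: "'k \<Rightarrow> complex" where emb: "complex_embedding S \<sigma>" and C: "C \<subseteq> S"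
    using finite_set_embeds by blast
  interpret complex_embedding S \<sigma>
    by (rule emb)
  have contraction: "bounded_by (\<rho> g f) c" if "bounded_by f c" for g f c
    using that by (cases g) (auto simp: \<rho>_def shift_bounded)
  have coeffs: "w \<in> Poly_Mapping.keys p \<Longrightarrow> Poly_Mapping.lookup p w \<in> S"
      "w \<in> Poly_Mapping.keys q \<Longrightarrow> Poly_Mapping.lookup q w \<in> S" for w
    using C by (auto simp: C_def)
  show False
    by (rule no_bounded_canonical_pair[OF poly_op_linear poly_op_linear
          poly_op_bounded[OF action contraction coeffs(1)]
          poly_op_bounded[OF action contraction coeffs(2)] commutator])
qed

end
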